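(* Let $f(x), g(x) \in \mathbf{Z}[x]$ with $g \neq 0$. Then there exist a positive integer $T$ and polynomials $p_i(x), r_i(x) \in \mathbf{Z}[x]$ for $i = 0, \dots, T-1$ such that for all sufficiently large $n$, writing $n = Tm + i$ with $0 \le i \le T-1$, \[ p_i(m) = \left\lfloor \frac{f(n)}{g(n)} \right\rfloor \quad \text{and} \quad r_i(m) = \left\{ \frac{f(n)}{g(n)} \right\} g(n). \]
   Context: For a real number $y$, $\lfloor y \rfloor$ is the greatest integer at most $y$ and $\{y\} = y - \lfloor y \rfloor$ is its fractional part. *)

theory Defs
  imports Complex_Main "HOL-Computational_Algebra.Polynomial"
begin

end

theory Submission
  imports Defs
begin

text \<open>
  Pseudo-division gives \<open>c f = g q + s\<close> with an integer \<open>c > 0\<close> and \<open>s\<close> of smaller degree than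
  \<open>g\<close>. For large \<open>n\<close> the floor of \<open>s(n)/g(n)\<close> is a constant \<open>\<delta> \<in> {0, -1}\<close>, so the floor of
  \<open>f(n)/g(n)\<close> is \<open>(q(n) + \<delta>) div c\<close>. Since \<open>q(n) mod c\<close> depends only on \<open>n mod c\<close>, this is a
  polynomial on each residue class modulo \<open>T = c\<close>.
\<close>

text \<open>Induction on the Horner form \<open>a + n * q(n)\<close>. Once \<open>q(n)\<close> has
  the sign of its leading coefficient, integrality makes its absolute value at least 1, so
  \<open>n * q(n)\<close> outweighs \<open>a\<close> as soon as \<open>n\<close> exceeds the
  absolute value of \<open>a\<close>.\<close>

lemma eventually_sgn_poly:
  fixes p :: "int poly"
  shows "\<forall>\<^sub>F n :: nat in sequentially. sgn (poly p (int n)) = sgn (lead_coeff p)"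
proof (induction p)
  case 0
  show ?case by simp
next
  case (pCons a q)
  show ?case
  proof (cases "q = 0")
    case True
    then show ?thesis by simp
  next
    case False
    have "sgn (poly (pCons a q) (int n)) = sgn (lead_coeff (pCons a q))"
      if sgn_q: "sgn (poly q (int n)) = sgn (lead_coeff q)" and n: "\<bar>a\<bar> < int n" for n
    proof -
      from False have "lead_coeff q \<noteq> 0" by simp
      then consider "lead_coeff q > 0" | "lead_coeff q < 0" by linarith
      then show ?thesis
      proof cases
        case 1
        with sgn_q have "poly q (int n) \<ge> 1" by (auto simp: sgn_if split: if_splits)
        then have "int n * 1 \<le> int n * poly q (int n)" by (intro mult_left_mono) auto
        with n have "poly (pCons a q) (int n) > 0" unfolding poly_pCons by linarith
        with 1 False show ?thesis by simp
      next
        case 2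
        with sgn_q have "poly q (int n) \<le> -1" by (auto simp: sgn_if split: if_splits)
        then have "int n * poly q (int n) \<le> int n * (-1)" by (intro mult_left_mono) auto
        with n have "poly (pCons a q) (int n) < 0" unfolding poly_pCons by linarith
        with 2 False show ?thesis by simp
      qed
    qed
    moreover have "\<forall>\<^sub>F n :: nat in sequentially. \<bar>a\<bar> < int n"
      using eventually_gt_at_top[of "nat \<bar>a\<bar>"] by eventually_elim linarith
    ultimately show ?thesis
      using pCons.IH by (auto elim: eventually_elim2)
  qed
qed

text \<open>Both \<open>g + s\<close> and \<open>g - s\<close> keep the leading coefficient of
  \<open>g\<close>, so for large \<open>n\<close> their values have the sign of \<open>g(n)\<close>.
  This says that \<open>s(n)\<close> is smaller than \<open>g(n)\<close> in absolute value, and the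
  signs then decide between the quotients 0 and -1.\<close>

lemma eventually_poly_div_const:
  fixes s g :: "int poly"
  assumes "g \<noteq> 0" and deg: "s = 0 \<or> degree s < degree g"
  obtains d :: int
  where "\<forall>\<^sub>F n :: nat in sequentially.
    poly g (int n) \<noteq> 0 \<and> poly s (int n) div poly g (int n) = d"
proof -
  \<comment> \<open>The value -1 belongs to opposite eventual signs. The case \<open>s = 0\<close>
    falls under 0, since its leading coefficient is 0.\<close>
  define d :: int where "d = (if sgn (lead_coeff s) * sgn (lead_coeff g) = -1 then -1 else 0)"
  have lc: "lead_coeff (g + s) = lead_coeff g" "lead_coeff (g - s) = lead_coeff g"
    using deg lead_coeff_add_le[of s g] lead_coeff_add_le[of "- s" g] by (auto simp: add.commute)
  have "lead_coeff g \<noteq> 0" using \<open>g \<noteq> 0\<close> by simp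
  have "poly g (int n) \<noteq> 0 \<and> poly s (int n) div poly g (int n) = d"
    if "sgn (poly g (int n)) = sgn (lead_coeff g)"
      and "sgn (poly s (int n)) = sgn (lead_coeff s)"
      and "sgn (poly (g + s) (int n)) = sgn (lead_coeff (g + s))"
      and "sgn (poly (g - s) (int n)) = sgn (lead_coeff (g - s))" for n
  proof -
    define a b where "a = poly s (int n)" and "b = poly g (int n)"
    have "b \<noteq> 0" using that(1) \<open>lead_coeff g \<noteq> 0\<close> by (auto simp: b_def sgn_if split: if_splits)
    have sgn_b: "sgn (b + a) = sgn b" "sgn (b - a) = sgn b"
      using that lc by (simp_all add: a_def b_def)
    have d: "d = (if sgn a * sgn b = -1 then -1 else 0)"
      using that by (simp add: d_def a_def b_def)
    have "a div b = d"
    proof (cases "b > 0")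
      case True
      \<comment> \<open>For opposite signs the quotient is -1, with remainder \<open>a + b\<close>;
        otherwise it is 0. The case of negative \<open>b\<close> mirrors this.\<close>
      with sgn_b have "- b < a" "a < b" by (auto simp: sgn_if split: if_splits)
      with True d show ?thesis
        by (cases "a < 0") (auto simp: sgn_if div_pos_pos_trivial intro: int_div_pos_eq[where r = "a + b"])
    next
      case False
      with \<open>b \<noteq> 0\<close> have "b < 0" by simp
      with sgn_b have "b < a" "a < - b" by (auto simp: sgn_if split: if_splits)
      with \<open>b < 0\<close> d show ?thesis
        by (cases "a > 0")
          (auto simp: sgn_if div_neg_neg_trivial intro: int_div_neg_eq[where r = "a + b"])
    qed
    with \<open>b \<noteq> 0\<close> show ?thesis by (simp add: a_def b_def)
  qed
  note div_eq_d = this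
  have "\<forall>\<^sub>F n :: nat in sequentially.
      poly g (int n) \<noteq> 0 \<and> poly s (int n) div poly g (int n) = d"
    using eventually_sgn_poly[of g] eventually_sgn_poly[of s]
      eventually_sgn_poly[of "g + s"] eventually_sgn_poly[of "g - s"]
    by eventually_elim (rule div_eq_d)
  then show thesis by (rule that)
qed

text \<open>This is the congruence of \<open>q(c m + i)\<close> and \<open>q(i)\<close> modulo
  \<open>c\<close>, with a cofactor that is itself a polynomial in \<open>m\<close>.\<close>

lemma poly_on_residue_class:
  fixes q :: "'a :: comm_ring_1 poly"
  shows "\<exists>Q. \<forall>m. poly q (c * m + i) = c * poly Q m + poly q i"
proof (induction q)
  case 0
  show ?case by (intro exI[of _ 0]) simp
next
  case (pCons a q)
  then obtain Q where "\<And>m. poly q (c * m + i) = c * poly Q m + poly q i" by blast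
  then show ?case
    \<comment> \<open>The witness collects the multiples of \<open>c\<close> in
      \<open>(i + c m) * (c Q(m) + q(i))\<close>, leaving \<open>i * q(i)\<close>.\<close>
    by (intro exI[of _ "[:i, c:] * Q + [:0, poly q i:]"]) (simp add: algebra_simps)
qed

lemma div_poly_on_residue_class:
  fixes q :: "int poly"
  assumes "c \<noteq> 0"
  obtains Q where "\<And>m. poly Q m = poly q (c * m + i) div c"
proof -
  obtain Q where "\<And>m. poly q (c * m + i) = c * poly Q m + poly q i"
    using poly_on_residue_class by blast
  with \<open>c \<noteq> 0\<close> have "poly (Q + [:poly q i div c:]) m = poly q (c * m + i) div c" for m
    by simp
  then show thesis by (rule that)
qed

lemma pseudo_division_pos:
  fixes f g :: "int poly"
  assumes "g \<noteq> 0"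
  obtains c :: int and q s
  where "c > 0" "smult c f = g * q + s" "s = 0 \<or> degree s < degree g"
proof -
  obtain q s where qs: "pseudo_divmod f g = (q, s)" by fastforce
  define a where "a = lead_coeff g ^ (Suc (degree f) - degree g)"
  have a: "smult a f = g * q + s" "s = 0 \<or> degree s < degree g"
    using pseudo_divmod[OF assms qs] by (simp_all add: a_def)
  have "a \<noteq> 0" using assms by (simp add: a_def)
  show thesis
  \<comment> \<open>The pseudo-division factor \<open>a\<close> may be negative; scaling by
    \<open>a\<close> once more turns it into a positive square.\<close>
  proof (rule that[of "a * a" "smult a q" "smult a s"])
    show "a * a > 0" using \<open>a \<noteq> 0\<close> by (metis not_real_square_gt_zero zero_less_mult_iff linorder_neqE)
    have "smult (a * a) f = smult a (smult a f)" by simp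
    also have "\<dots> = g * smult a q + smult a s" by (simp add: a(1) smult_add_right)
    finally show "smult (a * a) f = g * smult a q + smult a s" .
    show "smult a s = 0 \<or> degree (smult a s) < degree g" using a(2) by auto
  qed
qed

theorem theorem4p1:
  fixes f g :: "int poly"
  assumes "g \<noteq> 0"
  shows "\<exists>(T::nat) (p :: nat \<Rightarrow> int poly) (r :: nat \<Rightarrow> int poly). T > 0 \<and>
    (\<forall>\<^sub>F n :: nat in sequentially. \<forall>(m::nat) (i::nat). i < T \<longrightarrow> n = T * m + i \<longrightarrow>
       poly (p i) (int m) = \<lfloor>real_of_int (poly f (int n)) / real_of_int (poly g (int n))\<rfloor> \<and>
       real_of_int (poly (r i) (int m)) =
         frac (real_of_int (poly f (int n)) / real_of_int (poly g (int n))) * real_of_int (poly g (int n)))"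
proof -
  obtain c :: int and q s where c: "c > 0" "smult c f = g * q + s"
    and s: "s = 0 \<or> degree s < degree g"
    using pseudo_division_pos[OF assms] .
  obtain d where d: "\<forall>\<^sub>F n :: nat in sequentially.
      poly g (int n) \<noteq> 0 \<and> poly s (int n) div poly g (int n) = d"
    using eventually_poly_div_const[OF assms s] .
  have "\<exists>Q. \<forall>m. poly Q m = poly (q + [:d:]) (c * m + int i) div c" for i
    using div_poly_on_residue_class[of c "q + [:d:]" "int i"] c(1) by (metis less_irrefl)
  then obtain p where p: "\<And>i m. poly (p i) m = poly (q + [:d:]) (c * m + int i) div c"
    by metis
  \<comment> \<open>This is \<open>f(n) - p_i(m) g(n)\<close> as a polynomial in \<open>m\<close>,
    by substituting \<open>n = c m + i\<close>.\<close>
  define r where "r i = pcompose f [:int i, c:] - p i * pcompose g [:int i, c:]" for i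
  have "poly (p i) (int m) = \<lfloor>real_of_int (poly f (int n)) / real_of_int (poly g (int n))\<rfloor> \<and>
       real_of_int (poly (r i) (int m)) =
         frac (real_of_int (poly f (int n)) / real_of_int (poly g (int n))) * real_of_int (poly g (int n))"
    if n: "n = nat c * m + i"
      and g: "poly g (int n) \<noteq> 0" and sg: "poly s (int n) div poly g (int n) = d" for n m i
  proof -
    have n': "int n = c * int m + int i" using n c(1) by simp
    have "c * poly f (int n) = poly g (int n) * poly q (int n) + poly s (int n)"
      using c(2) by (metis poly_add poly_mult poly_smult)
    then have "poly q (int n) + d = c * poly f (int n) div poly g (int n)"
      using g sg by simp
    \<comment> \<open>Iterated floor division merges into one division because \<open>c\<close> is
      positive, whatever the sign of \<open>g(n)\<close>; the common factor \<open>c\<close> then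
      cancels.\<close>
    then have "(poly q (int n) + d) div c = (c * poly f (int n)) div (poly g (int n) * c)"
      using c(1) by (simp add: zdiv_zmult2_eq)
    also have "\<dots> = poly f (int n) div poly g (int n)"
      using c(1) by (simp add: mult.commute)
    finally have p_div: "poly (p i) (int m) = poly f (int n) div poly g (int n)"
      by (simp add: p n')
    then have p_floor:
      "poly (p i) (int m) = \<lfloor>real_of_int (poly f (int n)) / real_of_int (poly g (int n))\<rfloor>"
      by (simp add: floor_divide_of_int_eq)
    have "poly (r i) (int m) = poly f (int n) - poly (p i) (int m) * poly g (int n)"
      by (simp add: r_def poly_pcompose n' algebra_simps)
    with p_floor g show ?thesis
      by (simp add: frac_def left_diff_distrib)
  qed
  note floor_and_frac = this
  from d have "\<forall>\<^sub>F n :: nat in sequentially. \<forall>(m::nat) (i::nat). i < nat c \<longrightarrow> n = nat c * m + i \<longrightarrow>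
       poly (p i) (int m) = \<lfloor>real_of_int (poly f (int n)) / real_of_int (poly g (int n))\<rfloor> \<and>
       real_of_int (poly (r i) (int m)) =
         frac (real_of_int (poly f (int n)) / real_of_int (poly g (int n))) * real_of_int (poly g (int n))"
    by eventually_elim (use floor_and_frac in blast)
  moreover have "nat c > 0" using c(1) by simp
  ultimately show ?thesis by blast
qed

end
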